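(* Let $G=(V,E)$ be a finite graph. Then $h\bigl(R(\overline G)\bigr)\le 2^{h_1(G)}$ and $hd\bigl(R(\overline G)\bigr)\le |V|/2-1$.
   Context: $\overline G$ is the edge ideal of $G$ in $\mathbb{Z}[V]$, generated by the squares of the vertices and the products $uv$ over edges $\{u,v\}$; $R(\overline G)$ is the independence complex (the simplicial complex of independent sets); for the empty graph it is $\{1\}$, the $(-1)$-sphere $S^{-1}$. $h_1(G)=\kappa+|E|-|V|$ where $\kappa$ is the number of connected components. For a space $T$, $h(T)$ is the sum of the ranks of all reduced integral homology groups, and $hd(T)$ is $-\infty$ if all reduced homology vanishes and otherwise the largest $k$ with $\tilde H_k(T,\mathbb{Z})\ne0$; by convention $h(S^{-1})=1$ and $hd(S^{-1})=-1$. *)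

theory Defs
  imports "HOL-Homology.Homology" "HOL-Library.Ramsey" "HOL-Analysis.Infinite_Sum"
begin

definition finite_graph :: "'a set \<Rightarrow> 'a set set \<Rightarrow> bool" where
  "finite_graph V E \<longleftrightarrow> finite V \<and> (\<forall>e\<in>E. e \<subseteq> V \<and> card e = 2)"

definition graph_components :: "'a set \<Rightarrow> 'a set set \<Rightarrow> 'a set set" where
  "graph_components V E = V // {(u, v) \<in> V \<times> V. (u, v) \<in> {(x, y). {x, y} \<in> E}\<^sup>*}"

definition graph_h1 :: "'a set \<Rightarrow> 'a set set \<Rightarrow> int" where
  "graph_h1 V E = int (card (graph_components V E)) + int (card E) - int (card V)"

text \<open>The empty set is a face, so the complex of the empty graph is \<open>{{}}\<close>; it corresponds to
  the monomial 1 when faces are written as squarefree monomials outside the edge ideal.\<close>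

definition independence_complex :: "'a set \<Rightarrow> 'a set set \<Rightarrow> 'a set set" where
  "independence_complex V E = {S. S \<subseteq> V \<and> indep S E}"

text \<open>Barycentric coordinates, extended by 0 to the whole type. The topology is that of pointwise
  convergence, which is the usual one for finite complexes only. The realization of \<open>{{}}\<close> is the
  empty space, i.e. the (-1)-sphere.\<close>

definition geometric_realization :: "'a set set \<Rightarrow> ('a \<Rightarrow> real) topology" where
  "geometric_realization K = subtopology (powertop_real UNIV)
     {x. (\<forall>v. 0 \<le> x v) \<and> {v. x v \<noteq> 0} \<in> K \<and> (\<Sum>v | x v \<noteq> 0. x v) = 1}"

text \<open>The rank of an abelian group (written multiplicatively): the supremum of the sizes of its
  finite \<open>\<int>\<close>-linearly independent subsets.\<close>

definition int_independent :: "('g, 'm) monoid_scheme \<Rightarrow> 'g set \<Rightarrow> bool" where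
  "int_independent A B \<longleftrightarrow> finite B \<and> B \<subseteq> carrier A \<and>
     (\<forall>c :: 'g \<Rightarrow> int. (\<Otimes>\<^bsub>A\<^esub>b\<in>B. b [^]\<^bsub>A\<^esub> c b) = \<one>\<^bsub>A\<^esub> \<longrightarrow> (\<forall>b\<in>B. c b = 0))"

definition abelian_rank :: "('g, 'm) monoid_scheme \<Rightarrow> enat" where
  "abelian_rank A = (SUP B \<in> {B. int_independent A B}. enat (card B))"

text \<open>The library's \<^const>\<open>reduced_homology_group\<close> of the empty space is trivial in every degree,
  including -1, so the convention for the (-1)-sphere is imposed separately in the next two
  definitions.\<close>

definition total_betti :: "'a topology \<Rightarrow> enat" where
  "total_betti T = (if topspace T = {} then 1
     else (\<Sum>\<^sub>\<infinity>p\<in>UNIV. abelian_rank (reduced_homology_group p T)))"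

text \<open>If all reduced homology vanishes, the supremum is that of the empty set, which is
  \<open>-\<infinity>\<close> in \<^typ>\<open>ereal\<close>.\<close>

definition homological_dim :: "'a topology \<Rightarrow> ereal" where
  "homological_dim T = (if topspace T = {} then -1
     else (SUP k \<in> {k. \<not> trivial_group (reduced_homology_group k T)}. ereal (of_int k)))"

end

theory Submission
  imports Defs
begin

text \<open>For a vertex \<open>v\<close>, the complex \<open>Ind(G)\<close> is \<open>Ind(G - v)\<close> with a cone over \<open>Ind(G - N[v])\<close>
  attached, so the reduced homology of \<open>Ind(G)\<close> in degree \<open>k\<close> sits in an exact sequence between that of
  \<open>Ind(G - v)\<close> in degree \<open>k\<close> and that of \<open>Ind(G - N[v])\<close> in degree \<open>k - 1\<close>. If \<open>G\<close> has an isolated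
  vertex, \<open>Ind(G)\<close> is a cone. Since \<open>G - N[v]\<close> loses two vertices whenever \<open>v\<close> is not isolated, the
  degree bound follows by induction. For the rank bound, delete a vertex lying on a cycle, which lowers
  the cycle rank of both remaining graphs by at least one, or the neighbour of a leaf, which makes
  the first term vanish; an acyclic graph has fewer edges than vertices, hence a vertex of degree at
  most one.\<close>

section \<open>Ranks of abelian groups\<close>

text \<open>An indexed variant of \<open>int_independent\<close>, so that images of an independent
  set under a homomorphism can be discussed without first checking injectivity.\<close>

definition int_independent_family :: "('g, 'm) monoid_scheme \<Rightarrow> 'i set \<Rightarrow> ('i \<Rightarrow> 'g) \<Rightarrow> bool" where
  "int_independent_family G I b \<longleftrightarrow> finite I \<and> b \<in> I \<rightarrow> carrier G \<and>
     (\<forall>c :: 'i \<Rightarrow> int. (\<Otimes>\<^bsub>G\<^esub>i\<in>I. b i [^]\<^bsub>G\<^esub> c i) = \<one>\<^bsub>G\<^esub> \<longrightarrow> (\<forall>i\<in>I. c i = 0))"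

context comm_group
begin

lemma finprod_int_pow_add:
  assumes "b \<in> I \<rightarrow> carrier G"
  shows "(\<Otimes>i\<in>I. b i [^] (m i + n i :: int)) = (\<Otimes>i\<in>I. b i [^] m i) \<otimes> (\<Otimes>i\<in>I. b i [^] n i)"
proof -
  have "(\<Otimes>i\<in>I. b i [^] (m i + n i :: int)) = (\<Otimes>i\<in>I. b i [^] m i \<otimes> b i [^] n i)"
    by (rule finprod_cong') (use assms in \<open>auto simp: int_pow_mult Pi_iff\<close>)
  then show ?thesis
    using assms by (simp add: Pi_iff)
qed

lemma finprod_int_pow:
  assumes "b \<in> I \<rightarrow> carrier G"
  shows "(\<Otimes>i\<in>I. b i) [^] (e :: int) = (\<Otimes>i\<in>I. b i [^] e)"
  using assms
proof (induction I rule: infinite_finite_induct)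
  case (insert j I)
  then show ?case
    by (simp add: Pi_iff int_pow_distrib)
qed auto

text \<open>Substituting integer combinations into an integer combination: the exponents form the
  product of the matrix \<open>m\<close> with the vector \<open>e\<close>.\<close>

lemma finprod_finprod_int_pow:
  assumes "b \<in> I \<rightarrow> carrier G" "finite J"
  shows "(\<Otimes>j\<in>J. (\<Otimes>i\<in>I. b i [^] (m j i :: int)) [^] (e j :: int)) = (\<Otimes>i\<in>I. b i [^] (\<Sum>j\<in>J. m j i * e j))"
  using assms(2)
proof (induction J rule: finite_induct)
  case empty
  then show ?case by simp
next
  case (insert j J)
  have c: "(\<Otimes>i\<in>I. b i [^] (m j i :: int)) [^] (e j :: int) \<in> carrier G" for j
    using assms by (auto simp: Pi_iff intro!: int_pow_closed finprod_closed)
  have "(\<Otimes>i\<in>I. b i [^] m j i) [^] e j = (\<Otimes>i\<in>I. b i [^] (m j i * e j))"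
  proof -
    have "(\<Otimes>i\<in>I. b i [^] m j i) [^] e j = (\<Otimes>i\<in>I. (b i [^] m j i) [^] e j)"
      by (rule finprod_int_pow) (use assms in auto)
    also have "\<dots> = (\<Otimes>i\<in>I. b i [^] (m j i * e j))"
      by (rule finprod_cong') (use assms in \<open>auto simp: int_pow_pow Pi_iff\<close>)
    finally show ?thesis .
  qed
  then show ?case
    using insert c assms(1) by (subst finprod_insert) (auto simp: finprod_int_pow_add intro!: finprod_closed int_pow_closed)
qed

text \<open>Evaluates two-term relations; these show that a repeated element, or a pair of distinct
  integers, is dependent.\<close>

lemma finprod_int_pow_two:
  assumes "b \<in> I \<rightarrow> carrier G" "finite I" "i \<in> I" "j \<in> I" "i \<noteq> j"
    and "\<And>k. k \<in> I \<Longrightarrow> k \<noteq> i \<Longrightarrow> k \<noteq> j \<Longrightarrow> c k = (0::int)"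
  shows "(\<Otimes>k\<in>I. b k [^] c k) = b i [^] c i \<otimes> b j [^] c j"
proof -
  have "(\<Otimes>k\<in>I. b k [^] c k) = (\<Otimes>k\<in>{i,j}. b k [^] c k)"
    by (rule finprod_mono_neutral_cong_right) (use assms in \<open>auto simp: Pi_iff\<close>)
  then show ?thesis
    using assms by (auto simp: Pi_iff)
qed

text \<open>If two indices had the same value, the exponents 1 and -1 would give a nontrivial
  relation. Hence the family is injective and its image is an independent set of the same
  size.\<close>

lemma card_le_abelian_rank:
  assumes "int_independent_family G I b"
  shows "enat (card I) \<le> abelian_rank G"
proof -
  have fin: "finite I" and b: "b \<in> I \<rightarrow> carrier G"
    and ind: "\<And>c :: _ \<Rightarrow> int. (\<Otimes>i\<in>I. b i [^] c i) = \<one> \<Longrightarrow> (\<forall>i\<in>I. c i = 0)"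
    using assms by (auto simp: int_independent_family_def)
  have inj: "inj_on b I"
  proof (rule inj_onI, rule ccontr)
    fix i j assume ij: "i \<in> I" "j \<in> I" "b i = b j" "i \<noteq> j"
    define c :: "_ \<Rightarrow> int" where "c = (\<lambda>k. if k = i then 1 else if k = j then -1 else 0)"
    have "(\<Otimes>k\<in>I. b k [^] c k) = b i [^] c i \<otimes> b j [^] c j"
      by (rule finprod_int_pow_two) (use ij fin b in \<open>auto simp: c_def\<close>)
    also have "\<dots> = \<one>"
    proof -
      have "b j \<in> carrier G" using ij b by blast
      then show ?thesis using ij by (simp add: c_def int_pow_neg)
    qed
    finally show False
      using ind[of c] ij by (auto simp: c_def)
  qed
  have "int_independent G (b ` I)"
    unfolding int_independent_def
  proof (intro conjI allI impI)
    fix c :: "_ \<Rightarrow> int" assume c: "(\<Otimes>x\<in>b ` I. x [^] c x) = \<one>"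
    have "(\<Otimes>x\<in>b ` I. x [^] c x) = (\<Otimes>i\<in>I. b i [^] c (b i))"
      by (rule finprod_reindex) (use b inj in auto)
    then show "\<forall>x\<in>b ` I. c x = 0"
      using ind[of "c \<circ> b"] c by auto
  qed (use fin b in auto)
  moreover have "card (b ` I) = card I"
    using inj by (rule card_image)
  ultimately show ?thesis
    unfolding abelian_rank_def by (metis (mono_tags, lifting) SUP_upper mem_Collect_eq)
qed

end

section \<open>Behaviour of the rank under homomorphisms and exact sequences\<close>

lemma hom_finprod_int_pow:
  assumes "comm_group A" "comm_group B" "h \<in> hom A B" "b \<in> I \<rightarrow> carrier A"
  shows "h (\<Otimes>\<^bsub>A\<^esub>i\<in>I. b i [^]\<^bsub>A\<^esub> (c i :: int)) = (\<Otimes>\<^bsub>B\<^esub>i\<in>I. h (b i) [^]\<^bsub>B\<^esub> c i)"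
proof -
  interpret A: comm_group A by fact
  interpret B: comm_group B by fact
  interpret group_hom A B h by unfold_locales fact
  show ?thesis using assms(4)
  proof (induction I rule: infinite_finite_induct)
    case (insert j I)
    then show ?case
      by (simp add: Pi_iff hom_int_pow)
  qed auto
qed

lemma abelian_rank_le_iff:
  "abelian_rank G \<le> n \<longleftrightarrow> (\<forall>B. int_independent G B \<longrightarrow> enat (card B) \<le> n)"
  by (auto simp: abelian_rank_def SUP_le_iff)

text \<open>An injective homomorphism reflects relations, so it keeps independent sets
  independent.\<close>

lemma abelian_rank_mono:
  assumes "comm_group A" "comm_group B" "h \<in> hom A B" "inj_on h (carrier A)"
  shows "abelian_rank A \<le> abelian_rank B"
  unfolding abelian_rank_le_iff
proof (intro allI impI)
  fix I assume I: "int_independent A I"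
  interpret A: comm_group A by fact
  interpret B: comm_group B by fact
  interpret group_hom A B h by unfold_locales fact
  have IA: "I \<subseteq> carrier A"
    using I by (simp add: int_independent_def)
  have "int_independent_family B I h"
    unfolding int_independent_family_def
  proof (intro conjI allI impI)
    fix c :: "_ \<Rightarrow> int" assume c: "(\<Otimes>\<^bsub>B\<^esub>i\<in>I. h i [^]\<^bsub>B\<^esub> c i) = \<one>\<^bsub>B\<^esub>"
    have "h (\<Otimes>\<^bsub>A\<^esub>i\<in>I. i [^]\<^bsub>A\<^esub> c i) = h \<one>\<^bsub>A\<^esub>"
      using hom_finprod_int_pow[OF assms(1-3), of "\<lambda>x. x" I c] IA c by auto
    then have "(\<Otimes>\<^bsub>A\<^esub>i\<in>I. i [^]\<^bsub>A\<^esub> c i) = \<one>\<^bsub>A\<^esub>"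
      by (rule inj_onD[OF assms(4)]) (use IA in \<open>auto intro!: A.finprod_closed A.int_pow_closed\<close>)
    then show "\<forall>i\<in>I. c i = 0"
      using I by (auto simp: int_independent_def)
  qed (use I IA in \<open>auto simp: int_independent_def\<close>)
  then show "enat (card I) \<le> abelian_rank B"
    by (rule B.card_le_abelian_rank)
qed

lemma abelian_rank_iso:
  assumes "comm_group A" "comm_group B" "A \<cong> B"
  shows "abelian_rank A = abelian_rank B"
proof -
  have "B \<cong> A"
    using assms by (simp add: comm_group.axioms(2) group.iso_sym)
  then show ?thesis
    using assms by (auto simp: is_iso_def iso_def bij_betw_def intro!: antisym abelian_rank_mono)
qed

lemma abelian_rank_trivial_group:
  assumes "comm_group A" "trivial_group A"
  shows "abelian_rank A = 0"
proof -
  interpret A: comm_group A by fact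
  have "B = {}" if "int_independent A B" for B
  proof (rule ccontr)
    assume "B \<noteq> {}"
    have "B \<subseteq> {\<one>\<^bsub>A\<^esub>}"
      using that assms(2) by (auto simp: int_independent_def trivial_group_def)
    then have "(\<Otimes>\<^bsub>A\<^esub>i\<in>B. i [^]\<^bsub>A\<^esub> (1::int)) = \<one>\<^bsub>A\<^esub>"
      by (intro A.finprod_one_eqI) auto
    then have "\<forall>i\<in>B. (1::int) = 0"
      using that unfolding int_independent_def by (elim conjE allE[of _ "\<lambda>_. 1"]) simp
    then show False
      using \<open>B \<noteq> {}\<close> by auto
  qed
  then have "abelian_rank A \<le> 0"
    unfolding abelian_rank_le_iff by (metis card.empty order_refl zero_enat_def)
  then show ?thesis by simp
qed

lemma abelian_rank_integer_group: "abelian_rank integer_group \<le> 1"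
  unfolding abelian_rank_le_iff
proof (intro allI impI)
  fix B :: "int set" assume B: "int_independent integer_group B"
  interpret comm_group integer_group by (rule abelian_integer_group)
  have "a = b" if "a \<in> B" "b \<in> B" for a b
  proof (rule ccontr)
    assume "a \<noteq> b"
    \<comment> \<open>The relation b * a - a * b = 0 is nontrivial because two distinct integers are
      not both 0.\<close>
    define c where "c = (\<lambda>x. if x = a then b else if x = b then -a else 0)"
    have "(\<Otimes>\<^bsub>integer_group\<^esub>x\<in>B. x [^]\<^bsub>integer_group\<^esub> c x)
        = a [^]\<^bsub>integer_group\<^esub> c a \<otimes>\<^bsub>integer_group\<^esub> b [^]\<^bsub>integer_group\<^esub> c b"
      by (rule finprod_int_pow_two) (use that \<open>a \<noteq> b\<close> B in \<open>auto simp: c_def int_independent_def\<close>)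
    also have "\<dots> = \<one>\<^bsub>integer_group\<^esub>"
      using \<open>a \<noteq> b\<close> by (simp add: c_def)
    finally have "\<forall>x\<in>B. c x = 0"
      using B unfolding int_independent_def by blast
    then show False
      using that \<open>a \<noteq> b\<close> by (auto simp: c_def split: if_splits)
  qed
  then have "card B \<le> 1"
    using B by (simp add: int_independent_def card_le_Suc0_iff_eq)
  then show "enat (card B) \<le> 1"
    by (simp add: one_enat_def)
qed

text \<open>Take a maximal subset of the given independent set whose image in \<open>C\<close> is independent:
  every remaining element \<open>j\<close> yields a relation with nonzero coefficient at \<open>j\<close>, which lifts to \<open>A\<close>,
  and these lifts are independent because their matrix is diagonal on the remaining elements.\<close>

lemma abelian_rank_exact_le:
  assumes "comm_group A" "comm_group B" "comm_group C" "f \<in> hom A B" "g \<in> hom B C"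
    and exact: "kernel B C g = f ` carrier A"
  shows "abelian_rank B \<le> abelian_rank A + abelian_rank C"
  unfolding abelian_rank_le_iff
proof (intro allI impI)
  fix I assume I: "int_independent B I"
  interpret A: comm_group A by fact
  interpret B: comm_group B by fact
  interpret C: comm_group C by fact
  interpret f: group_hom A B f by unfold_locales fact
  interpret g: group_hom B C g by unfold_locales fact
  have fin: "finite I" and IB: "I \<subseteq> carrier B"
    and ind: "\<And>c :: _ \<Rightarrow> int. (\<Otimes>\<^bsub>B\<^esub>i\<in>I. i [^]\<^bsub>B\<^esub> c i) = \<one>\<^bsub>B\<^esub> \<Longrightarrow> \<forall>i\<in>I. c i = 0"
    using I by (auto simp: int_independent_def)
  let ?P = "\<lambda>S. S \<subseteq> I \<and> int_independent_family C S g"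
  have "finite {S. ?P S}"
    by (rule finite_subset[of _ "Pow I"]) (use fin in auto)
  moreover have "{} \<in> {S. ?P S}"
    by (simp add: int_independent_family_def)
  ultimately obtain S where "S \<in> {S. ?P S}" and max: "\<And>T. T \<in> {S. ?P S} \<Longrightarrow> S \<subseteq> T \<Longrightarrow> S = T"
    by (metis (lifting) empty_iff finite_has_maximal)
  then have SI: "S \<subseteq> I" and S: "int_independent_family C S g" by auto
  have finS: "finite S" using SI fin by (rule finite_subset)
  have gS: "g \<in> S \<rightarrow> carrier C" using SI IB by auto
  define J where "J = I - S"
  have "\<exists>c a. c j \<noteq> 0 \<and> (\<forall>i\<in>J - {j}. c i = 0) \<and> a \<in> carrier A \<and> f a = (\<Otimes>\<^bsub>B\<^esub>i\<in>I. i [^]\<^bsub>B\<^esub> (c i :: int))"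
    if "j \<in> J" for j
  proof -
    have j: "j \<in> I" "j \<notin> S" using that by (auto simp: J_def)
    \<comment> \<open>By maximality of \<open>S\<close>, adding any further \<open>j\<close> creates
      a relation in \<open>C\<close>. Its coefficient at \<open>j\<close> cannot vanish, since
      otherwise it would be a relation on \<open>S\<close> alone.\<close>
    have "\<not> int_independent_family C (insert j S) g"
      using max[of "insert j S"] j SI by auto
    moreover have "finite (insert j S)" "g \<in> insert j S \<rightarrow> carrier C"
      using finS gS j IB by auto
    ultimately obtain c :: "_ \<Rightarrow> int" where c: "(\<Otimes>\<^bsub>C\<^esub>i\<in>insert j S. g i [^]\<^bsub>C\<^esub> c i) = \<one>\<^bsub>C\<^esub>"
      and nz: "\<exists>i\<in>insert j S. c i \<noteq> 0"
      unfolding int_independent_family_def by blast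
    have cj: "c j \<noteq> 0"
    proof
      assume "c j = 0"
      then have "(\<Otimes>\<^bsub>C\<^esub>i\<in>S. g i [^]\<^bsub>C\<^esub> c i) = \<one>\<^bsub>C\<^esub>"
        using c finS gS j IB by (simp add: Pi_iff subset_iff)
      then have "\<forall>i\<in>S. c i = 0"
        using S by (simp add: int_independent_family_def)
      then show False using nz \<open>c j = 0\<close> by auto
    qed
    \<comment> \<open>Extending the relation by 0 to all of \<open>I\<close> gives a combination in
      \<open>B\<close> that \<open>g\<close> kills; exactness then writes it as an image under
      \<open>f\<close>.\<close>
    define c' where "c' = (\<lambda>i. if i \<in> insert j S then c i else 0)"
    have "g (\<Otimes>\<^bsub>B\<^esub>i\<in>I. i [^]\<^bsub>B\<^esub> c' i) = (\<Otimes>\<^bsub>C\<^esub>i\<in>I. g i [^]\<^bsub>C\<^esub> c' i)"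
      by (rule hom_finprod_int_pow) (use assms IB in auto)
    also have "\<dots> = (\<Otimes>\<^bsub>C\<^esub>i\<in>insert j S. g i [^]\<^bsub>C\<^esub> c i)"
      by (rule C.finprod_mono_neutral_cong_right) (use fin SI j IB in \<open>auto simp: c'_def Pi_iff\<close>)
    finally have "(\<Otimes>\<^bsub>B\<^esub>i\<in>I. i [^]\<^bsub>B\<^esub> c' i) \<in> kernel B C g"
      using c IB by (auto simp: kernel_def Pi_iff subset_iff)
    then obtain a where "a \<in> carrier A" "f a = (\<Otimes>\<^bsub>B\<^esub>i\<in>I. i [^]\<^bsub>B\<^esub> c' i)"
      unfolding exact by auto
    moreover have "c' j \<noteq> 0" "\<forall>i\<in>J - {j}. c' i = 0"
      using cj by (auto simp: c'_def J_def)
    ultimately show ?thesis by blast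
  qed
  then have "\<forall>j\<in>J. \<exists>c a. c j \<noteq> 0 \<and> (\<forall>i\<in>J - {j}. c i = 0) \<and> a \<in> carrier A
      \<and> f a = (\<Otimes>\<^bsub>B\<^esub>i\<in>I. i [^]\<^bsub>B\<^esub> (c i :: int))"
    by blast
  then obtain m where "\<forall>j\<in>J. \<exists>a. m j j \<noteq> 0 \<and> (\<forall>i\<in>J - {j}. m j i = 0) \<and> a \<in> carrier A
      \<and> f a = (\<Otimes>\<^bsub>B\<^esub>i\<in>I. i [^]\<^bsub>B\<^esub> (m j i :: int))"
    by (rule bchoice[THEN exE])
  then obtain a where "\<forall>j\<in>J. m j j \<noteq> 0 \<and> (\<forall>i\<in>J - {j}. m j i = 0) \<and> a j \<in> carrier A
      \<and> f (a j) = (\<Otimes>\<^bsub>B\<^esub>i\<in>I. i [^]\<^bsub>B\<^esub> m j i)"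
    by (rule bchoice[THEN exE])
  then have m: "\<And>j. j \<in> J \<Longrightarrow> m j j \<noteq> 0"
    and m0: "\<And>j i. j \<in> J \<Longrightarrow> i \<in> J \<Longrightarrow> i \<noteq> j \<Longrightarrow> m j i = 0"
    and aA: "\<And>j. j \<in> J \<Longrightarrow> a j \<in> carrier A"
    and fa: "\<And>j. j \<in> J \<Longrightarrow> f (a j) = (\<Otimes>\<^bsub>B\<^esub>i\<in>I. i [^]\<^bsub>B\<^esub> m j i)"
    by auto
  have finJ: "finite J" using fin by (simp add: J_def)
  have "int_independent_family A J a"
    unfolding int_independent_family_def
  proof (intro conjI allI impI ballI)
    fix e :: "_ \<Rightarrow> int" and j
    assume e: "(\<Otimes>\<^bsub>A\<^esub>j\<in>J. a j [^]\<^bsub>A\<^esub> e j) = \<one>\<^bsub>A\<^esub>" and j: "j \<in> J"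
    have "\<one>\<^bsub>B\<^esub> = f (\<Otimes>\<^bsub>A\<^esub>j\<in>J. a j [^]\<^bsub>A\<^esub> e j)"
      by (simp add: e)
    also have "\<dots> = (\<Otimes>\<^bsub>B\<^esub>j\<in>J. f (a j) [^]\<^bsub>B\<^esub> e j)"
      by (rule hom_finprod_int_pow) (use assms aA in auto)
    also have "\<dots> = (\<Otimes>\<^bsub>B\<^esub>j\<in>J. (\<Otimes>\<^bsub>B\<^esub>i\<in>I. i [^]\<^bsub>B\<^esub> m j i) [^]\<^bsub>B\<^esub> e j)"
      using IB by (intro B.finprod_cong') (auto simp: fa intro!: B.int_pow_closed B.finprod_closed)
    also have "\<dots> = (\<Otimes>\<^bsub>B\<^esub>i\<in>I. i [^]\<^bsub>B\<^esub> (\<Sum>j\<in>J. m j i * e j))"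
      by (rule B.finprod_finprod_int_pow) (use IB finJ in auto)
    finally have "\<forall>i\<in>I. (\<Sum>j\<in>J. m j i * e j) = 0"
      using ind[of "\<lambda>i. \<Sum>j\<in>J. m j i * e j"] by simp
    then have "0 = (\<Sum>k\<in>J. m k j * e k)"
      using j by (auto simp: J_def)
    also have "\<dots> = m j j * e j"
      using finJ j m0 by (subst sum.remove[of _ j]) (force intro!: sum.neutral)+
    finally show "e j = 0"
      using m j by auto
  qed (use finJ aA in auto)
  then have "enat (card J) \<le> abelian_rank A"
    by (rule A.card_le_abelian_rank)
  moreover have "enat (card S) \<le> abelian_rank C"
    using S by (rule C.card_le_abelian_rank)
  moreover have "card I = card J + card S"
    using SI fin finS by (simp add: J_def card_Diff_subset card_mono)
  ultimately show "enat (card I) \<le> abelian_rank A + abelian_rank C"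
    using add_mono by fastforce
qed

section \<open>Cycle rank of induced subgraphs\<close>

definition adjacency :: "'a set set \<Rightarrow> 'a set \<Rightarrow> ('a \<times> 'a) set" where
  "adjacency E W = {(x, y). {x, y} \<in> E \<inter> Pow W}"

definition component_of :: "'a set set \<Rightarrow> 'a set \<Rightarrow> 'a \<Rightarrow> 'a set" where
  "component_of E W u = {w \<in> W. (u, w) \<in> (adjacency E W)\<^sup>*}"

definition neighbours :: "'a set set \<Rightarrow> 'a set \<Rightarrow> 'a \<Rightarrow> 'a set" where
  "neighbours E W v = {u \<in> W. {u, v} \<in> E}"

definition induced_h1 :: "'a set set \<Rightarrow> 'a set \<Rightarrow> int" where
  "induced_h1 E W = graph_h1 W (E \<inter> Pow W)"

lemma graph_components_induced: "graph_components W (E \<inter> Pow W) = component_of E W ` W"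
  unfolding graph_components_def quotient_def component_of_def adjacency_def by auto

lemma adjacency_rtrancl_sym: "(u, w) \<in> (adjacency E W)\<^sup>* \<Longrightarrow> (w, u) \<in> (adjacency E W)\<^sup>*"
proof -
  have "sym (adjacency E W)"
    by (auto simp: adjacency_def sym_def insert_commute)
  then show "(u, w) \<in> (adjacency E W)\<^sup>* \<Longrightarrow> (w, u) \<in> (adjacency E W)\<^sup>*"
    using sym_rtrancl symD by metis
qed

lemma adjacency_mono: "W \<subseteq> U \<Longrightarrow> adjacency E W \<subseteq> adjacency E U"
  by (auto simp: adjacency_def)

lemma component_of_refl: "u \<in> W \<Longrightarrow> u \<in> component_of E W u"
  by (simp add: component_of_def)

lemma component_of_eq:
  assumes "(u, w) \<in> (adjacency E W)\<^sup>*"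
  shows "component_of E W u = component_of E W w"
  unfolding component_of_def
  using assms adjacency_rtrancl_sym[OF assms] rtrancl_trans by fast

lemma component_of_eq_iff:
  assumes "u \<in> W" "w \<in> W"
  shows "component_of E W u = component_of E W w \<longleftrightarrow> (u, w) \<in> (adjacency E W)\<^sup>*"
  using assms component_of_eq component_of_refl by (fastforce simp: component_of_def)

text \<open>A component containing a neighbour \<open>n\<close> of \<open>v\<close> is the component
  of \<open>n\<close>. These are the components that \<open>v\<close> glues together.\<close>

lemma components_meeting_neighbours:
  "{C \<in> component_of E W ` W. C \<inter> neighbours E W v \<noteq> {}} = component_of E W ` neighbours E W v"
proof (intro equalityI subsetI)
  fix C assume "C \<in> {C \<in> component_of E W ` W. C \<inter> neighbours E W v \<noteq> {}}"
  then obtain u n where "u \<in> W" "C = component_of E W u" "n \<in> C" "n \<in> neighbours E W v" by auto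
  then show "C \<in> component_of E W ` neighbours E W v"
    using component_of_eq[of u n E W] by (auto simp: component_of_def)
next
  fix C assume "C \<in> component_of E W ` neighbours E W v"
  then show "C \<in> {C \<in> component_of E W ` W. C \<inter> neighbours E W v \<noteq> {}}"
    using component_of_refl[of _ W E] by (fastforce simp: neighbours_def)
qed

text \<open>Follow a walk from \<open>v\<close>: each step returns to \<open>v\<close>, moves from
  \<open>v\<close> to a neighbour, or stays inside a component of \<open>W\<close> already entered
  through a neighbour.\<close>

lemma component_of_insert_vertex:
  assumes "v \<notin> W"
  shows "component_of E (insert v W) v = insert v (\<Union>(component_of E W ` neighbours E W v))" (is "?L = ?R")
proof (intro equalityI subsetI)
  fix x assume "x \<in> ?L"
  then have "(v, x) \<in> (adjacency E (insert v W))\<^sup>*" by (simp add: component_of_def)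
  then show "x \<in> ?R"
  proof (induction rule: rtrancl_induct)
    case (step y z)
    then consider "z = v" | "y = v" "z \<noteq> v" | n where "y \<noteq> v" "z \<noteq> v" "n \<in> neighbours E W v" "y \<in> component_of E W n"
      by auto
    then show ?case
    proof cases
      case 2
      then have "z \<in> neighbours E W v"
        using step.hyps by (auto simp: adjacency_def neighbours_def insert_commute)
      then show ?thesis using component_of_refl[of z W E] by (auto simp: neighbours_def)
    next
      case 3
      then have "(y, z) \<in> adjacency E W"
        using step.hyps by (auto simp: adjacency_def)
      then have "z \<in> component_of E W n"
        using 3 by (auto simp: component_of_def adjacency_def intro: rtrancl_into_rtrancl)
      then show ?thesis using 3 by auto
    qed simp
  qed simp
next
  fix x assume "x \<in> ?R"
  then consider "x = v" | n where "n \<in> neighbours E W v" "x \<in> component_of E W n" by auto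
  then show "x \<in> ?L"
  proof cases
    case 2
    have "(v, n) \<in> adjacency E (insert v W)"
      using 2 by (auto simp: adjacency_def neighbours_def insert_commute)
    moreover have "(n, x) \<in> (adjacency E (insert v W))\<^sup>*"
      using 2 rtrancl_mono[OF adjacency_mono[of W "insert v W"]] by (auto simp: component_of_def)
    ultimately show ?thesis
      using 2 by (auto simp: component_of_def intro: converse_rtrancl_into_rtrancl)
  qed (simp add: component_of_def)
qed

text \<open>A walk starting in such a component never meets a neighbour of \<open>v\<close>, hence
  never reaches \<open>v\<close>.\<close>

lemma component_of_insert_disjoint:
  assumes "v \<notin> W" "u \<in> W" "component_of E W u \<inter> neighbours E W v = {}"
  shows "component_of E (insert v W) u = component_of E W u"
proof (intro equalityI subsetI)
  fix x assume "x \<in> component_of E (insert v W) u"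
  then have "(u, x) \<in> (adjacency E (insert v W))\<^sup>*" by (simp add: component_of_def)
  then show "x \<in> component_of E W u"
  proof (induction rule: rtrancl_induct)
    case base
    then show ?case using assms by (simp add: component_of_def)
  next
    case (step y z)
    have "y \<in> W" using step.IH by (simp add: component_of_def)
    have "z \<noteq> v"
      using step assms(3) \<open>y \<in> W\<close> by (auto simp: adjacency_def neighbours_def)
    then have "(y, z) \<in> adjacency E W"
      using step \<open>y \<in> W\<close> assms(1) by (auto simp: adjacency_def)
    then show ?case
      using step.IH by (auto simp: component_of_def adjacency_def intro: rtrancl_into_rtrancl)
  qed
next
  fix x assume "x \<in> component_of E W u"
  then show "x \<in> component_of E (insert v W) u"
    using rtrancl_mono[OF adjacency_mono[of W "insert v W" E]] by (auto simp: component_of_def)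
qed

text \<open>The new vertex merges all components containing one of its neighbours into a single one
  and leaves the others untouched.\<close>

lemma components_insert_vertex:
  assumes "v \<notin> W"
  shows "component_of E (insert v W) ` insert v W =
    insert (component_of E (insert v W) v) {C \<in> component_of E W ` W. C \<inter> neighbours E W v = {}}" (is "?L = ?R")
proof (intro equalityI subsetI)
  fix C assume "C \<in> ?L"
  then obtain u where u: "u \<in> insert v W" "C = component_of E (insert v W) u" by auto
  show "C \<in> ?R"
  proof (cases "u \<in> W \<and> component_of E W u \<inter> neighbours E W v = {}")
    case True
    then show ?thesis using u component_of_insert_disjoint[OF assms, of u E] by auto
  next
    case False
    have "u \<in> component_of E (insert v W) v"
    proof (cases "u = v")
      case True
      then show ?thesis by (simp add: component_of_def)
    next
      assume "u \<noteq> v"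
      then obtain n where "n \<in> neighbours E W v" "n \<in> component_of E W u"
        using False u by auto
      then have "u \<in> component_of E W n"
        using \<open>u \<noteq> v\<close> u adjacency_rtrancl_sym by (fastforce simp: component_of_def)
      then show ?thesis
        using component_of_insert_vertex[OF assms, of E] \<open>n \<in> neighbours E W v\<close> by auto
    qed
    then have "component_of E (insert v W) v = C"
      using u component_of_eq[of v u E "insert v W"] by (simp add: component_of_def)
    then show ?thesis by simp
  qed
next
  fix C assume "C \<in> ?R"
  then consider "C = component_of E (insert v W) v"
    | u where "u \<in> W" "C = component_of E W u" "component_of E W u \<inter> neighbours E W v = {}"
    by blast
  then show "C \<in> ?L"
  proof cases
    case 2
    then have "C = component_of E (insert v W) u"
      using component_of_insert_disjoint[OF assms] by metis
    then show ?thesis using 2 by blast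
  qed simp
qed

text \<open>The new edges all contain \<open>v\<close>, and having two elements they correspond
  bijectively to their other endpoints, the neighbours of \<open>v\<close>.\<close>

lemma card_edges_insert_vertex:
  assumes "finite W" "v \<notin> W" "\<forall>e\<in>E. card e = 2"
  shows "card (E \<inter> Pow (insert v W)) = card (E \<inter> Pow W) + card (neighbours E W v)"
proof -
  have eq: "E \<inter> Pow (insert v W) = (E \<inter> Pow W) \<union> (\<lambda>u. {u, v}) ` neighbours E W v" (is "?L = ?R")
  proof (intro equalityI subsetI)
    fix e assume e: "e \<in> ?L"
    then obtain a b where ab: "e = {a, b}" "a \<noteq> b"
      using assms(3) by (metis IntD1 card_2_iff)
    consider "v \<notin> e" | "a = v" | "b = v" using ab by auto
    then show "e \<in> ?R"
    proof cases
      case 2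
      then have "b \<in> neighbours E W v" "e = {b, v}" using e ab by (auto simp: neighbours_def insert_commute)
      then show ?thesis by blast
    next
      case 3
      then have "a \<in> neighbours E W v" "e = {a, v}" using e ab by (auto simp: neighbours_def insert_commute)
      then show ?thesis by blast
    qed (use e in auto)
  qed (auto simp: neighbours_def)
  have "inj_on (\<lambda>u. {u, v}) (neighbours E W v)"
    using assms(2) by (auto simp: inj_on_def neighbours_def doubleton_eq_iff)
  moreover have "(E \<inter> Pow W) \<inter> (\<lambda>u. {u, v}) ` neighbours E W v = {}"
    using assms(2) by auto
  moreover have "finite (neighbours E W v)" using assms(1) by (simp add: neighbours_def)
  ultimately show ?thesis
    unfolding eq using assms(1) by (subst card_Un_disjoint) (auto simp: card_image)
qed

text \<open>Let d be the number of neighbours and c the number of components they meet. Adding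
  \<open>v\<close> changes the component count by 1 - c, the edge count by d and the vertex count by
  1, which gives d - c in total.\<close>

lemma induced_h1_insert_vertex:
  assumes "finite W" "v \<notin> W" "\<forall>e\<in>E. card e = 2"
  shows "induced_h1 E (insert v W) =
    induced_h1 E W + int (card (neighbours E W v)) - int (card (component_of E W ` neighbours E W v))"
proof -
  let ?K = "component_of E W ` W" and ?N = "neighbours E W v"
  let ?D = "{C \<in> ?K. C \<inter> ?N = {}}"
  have fin: "finite ?K" using assms(1) by simp
  have "v \<in> component_of E (insert v W) v" by (simp add: component_of_def)
  moreover have "v \<notin> C" if "C \<in> ?K" for C
    using that assms(2) by (auto simp: component_of_def)
  ultimately have "component_of E (insert v W) v \<notin> ?D" by blast
  then have "card (component_of E (insert v W) ` insert v W) = Suc (card ?D)"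
    unfolding components_insert_vertex[OF assms(2)] using fin by simp
  moreover have "?K = ?D \<union> component_of E W ` ?N" "?D \<inter> component_of E W ` ?N = {}"
    unfolding components_meeting_neighbours[symmetric] by auto
  then have "card ?K = card ?D + card (component_of E W ` ?N)"
    using fin by (metis (no_types, lifting) card_Un_disjoint finite_Un)
  ultimately show ?thesis
    using assms card_edges_insert_vertex[OF assms]
    by (simp add: induced_h1_def graph_h1_def graph_components_induced del: image_insert)
qed

text \<open>Adding one vertex changes the cycle rank by a nonnegative amount, since the neighbours
  meet at most as many components as there are neighbours.\<close>

lemma induced_h1_mono:
  assumes "finite U" "W \<subseteq> U" "\<forall>e\<in>E. card e = 2"
  shows "induced_h1 E W \<le> induced_h1 E U"
proof -
  have "finite (U - W)" using assms by simp
  moreover have "induced_h1 E W \<le> induced_h1 E (W \<union> D)" if "finite D" "finite W" for D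
    using that(1)
  proof (induction D rule: finite_induct)
    case (insert v D)
    show ?case
    proof (cases "v \<in> W")
      case True
      then show ?thesis using insert by (simp add: insert_absorb)
    next
      case False
      have "card (component_of E (W \<union> D) ` neighbours E (W \<union> D) v) \<le> card (neighbours E (W \<union> D) v)"
        using that insert by (intro card_image_le) (auto simp: neighbours_def)
      then show ?thesis
        using induced_h1_insert_vertex[of "W \<union> D" v E] insert False that assms(3) by simp
    qed
  qed simp
  ultimately have "induced_h1 E W \<le> induced_h1 E (W \<union> (U - W))"
    using assms finite_subset by blast
  then show ?thesis using assms(2) by (simp add: Un_absorb1)
qed

section \<open>Vertices on cycles, and vertices of low degree in forests\<close>

lemma induced_h1_empty [simp]: "induced_h1 E {} = (if {} \<in> E then 1 else 0)"
  using graph_components_induced[of "{}" E] by (simp add: induced_h1_def graph_h1_def)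

text \<open>This expresses that \<open>v\<close> lies on a cycle: a walk avoiding \<open>v\<close>
  between two of its neighbours closes up through \<open>v\<close>. In this form it says that two
  neighbours share a component of \<open>W - {v}\<close>, which is what
  \<open>induced_h1_insert_vertex\<close> measures.\<close>

definition cycle_vertex :: "'a set set \<Rightarrow> 'a set \<Rightarrow> 'a \<Rightarrow> bool" where
  "cycle_vertex E W v \<longleftrightarrow> v \<in> W \<and> (\<exists>a b. a \<noteq> b \<and> a \<in> neighbours E (W - {v}) v \<and> b \<in> neighbours E (W - {v}) v
     \<and> (a, b) \<in> (adjacency E (W - {v}))\<^sup>*)"

lemma cycle_vertex_mono:
  assumes "cycle_vertex E W v" "W \<subseteq> U"
  shows "cycle_vertex E U v"
proof -
  have "(adjacency E (W - {v}))\<^sup>* \<subseteq> (adjacency E (U - {v}))\<^sup>*"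
    using assms(2) by (intro rtrancl_mono adjacency_mono) auto
  then show ?thesis
    using assms unfolding cycle_vertex_def neighbours_def by blast
qed

text \<open>Two neighbours share a component, so the neighbours outnumber the components they meet
  and restoring \<open>v\<close> raises the cycle rank.\<close>

lemma induced_h1_cycle_vertex:
  assumes "finite W" "\<forall>e\<in>E. card e = 2" "cycle_vertex E W v"
  shows "induced_h1 E (W - {v}) < induced_h1 E W"
proof -
  let ?N = "neighbours E (W - {v}) v"
  have v: "insert v (W - {v}) = W" using assms(3) by (auto simp: cycle_vertex_def)
  have fin: "finite ?N" using assms(1) by (simp add: neighbours_def)
  have "\<not> inj_on (component_of E (W - {v})) ?N"
    using assms(3) component_of_eq unfolding cycle_vertex_def inj_on_def by fast
  then have "card (component_of E (W - {v}) ` ?N) < card ?N"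
    using fin by (meson card_image_le eq_card_imp_inj_on le_neq_implies_less)
  then show ?thesis
    using induced_h1_insert_vertex[of "W - {v}" v E] assms v by simp
qed

text \<open>Build \<open>W\<close> one vertex at a time. Subsets inherit the absence of cycle
  vertices, so the neighbours of each new vertex lie in distinct components and the cycle rank stays
  0.\<close>

lemma induced_h1_no_cycle_vertex:
  assumes "finite W" "\<forall>e\<in>E. card e = 2" "\<forall>v. \<not> cycle_vertex E W v"
  shows "induced_h1 E W = 0"
  using assms(1,3)
proof (induction W rule: finite_induct)
  case empty
  then show ?case using assms(2) by auto
next
  case (insert v W)
  have "inj_on (component_of E W) (neighbours E W v)"
  proof (rule inj_onI, rule ccontr)
    fix a b assume ab: "a \<in> neighbours E W v" "b \<in> neighbours E W v"
      "component_of E W a = component_of E W b" "a \<noteq> b"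
    then have "(a, b) \<in> (adjacency E W)\<^sup>*"
      by (subst component_of_eq_iff[symmetric]) (auto simp: neighbours_def)
    then have "cycle_vertex E (insert v W) v"
      using ab insert.hyps by (auto simp: cycle_vertex_def)
    then show False using insert.prems by blast
  qed
  then have "card (component_of E W ` neighbours E W v) = card (neighbours E W v)"
    by (rule card_image)
  moreover have "\<forall>u. \<not> cycle_vertex E W u"
    using insert.prems cycle_vertex_mono[OF _ subset_insertI] by metis
  ultimately show ?case
    using insert induced_h1_insert_vertex[of W v E] assms(2) by simp
qed

text \<open>The handshake lemma, by double counting incidences of vertices and edges.\<close>

lemma sum_card_neighbours:
  assumes "finite W" "\<forall>e\<in>E. card e = 2"
  shows "(\<Sum>v\<in>W. card (neighbours E W v)) = 2 * card (E \<inter> Pow W)"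
proof -
  have "card (neighbours E W v) = card {e \<in> E \<inter> Pow W. v \<in> e}" if "v \<in> W" for v
  proof -
    have "bij_betw (\<lambda>u. {u, v}) (neighbours E W v) {e \<in> E \<inter> Pow W. v \<in> e}"
      unfolding bij_betw_def
    proof (intro conjI equalityI subsetI)
      show "inj_on (\<lambda>u. {u, v}) (neighbours E W v)"
        by (auto simp: inj_on_def doubleton_eq_iff)
      fix e assume e: "e \<in> {e \<in> E \<inter> Pow W. v \<in> e}"
      then obtain a b where ab: "e = {a, b}" "a \<noteq> b"
        using assms(2) by (metis (no_types, lifting) IntD1 card_2_iff mem_Collect_eq)
      define u where "u = (if a = v then b else a)"
      have "e = {u, v}" using ab e by (auto simp: u_def)
      moreover have "u \<in> neighbours E W v" using e \<open>e = {u, v}\<close> by (auto simp: neighbours_def)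
      ultimately show "e \<in> (\<lambda>u. {u, v}) ` neighbours E W v" by blast
    qed (use that in \<open>auto simp: neighbours_def\<close>)
    then show ?thesis by (rule bij_betw_same_card)
  qed
  then have "(\<Sum>v\<in>W. card (neighbours E W v)) = (\<Sum>v\<in>W. \<Sum>e | e \<in> E \<inter> Pow W \<and> v \<in> e. 1)"
    by simp
  also have "\<dots> = (\<Sum>e\<in>E \<inter> Pow W. \<Sum>v | v \<in> W \<and> v \<in> e. 1)"
    using assms(1) by (intro sum.swap_restrict) auto
  also have "\<dots> = (\<Sum>e\<in>E \<inter> Pow W. 2)"
  proof (rule sum.cong)
    fix e assume "e \<in> E \<inter> Pow W"
    then have "{v. v \<in> W \<and> v \<in> e} = e" "card e = 2" using assms(2) by auto
    then show "(\<Sum>v | v \<in> W \<and> v \<in> e. 1) = (2::nat)" by simp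
  qed simp
  finally show ?thesis by simp
qed

text \<open>Without cycle vertices the cycle rank is 0, and as there is at least one component,
  there are fewer edges than vertices. If all degrees were at least 2, the handshake lemma would
  give at least as many edges as vertices.\<close>

lemma cycle_vertex_or_low_degree:
  assumes "finite W" "W \<noteq> {}" "\<forall>e\<in>E. card e = 2"
  shows "(\<exists>v. cycle_vertex E W v) \<or> (\<exists>v\<in>W. card (neighbours E W v) \<le> 1)"
proof (rule ccontr)
  assume *: "\<not> ?thesis"
  then have "induced_h1 E W = 0"
    using induced_h1_no_cycle_vertex assms by blast
  moreover have "card (component_of E W ` W) > 0"
    using assms by (simp add: card_gt_0_iff)
  ultimately have "card (E \<inter> Pow W) < card W"
    by (simp add: induced_h1_def graph_h1_def graph_components_induced)
  moreover have "(\<Sum>v\<in>W. 2) \<le> (\<Sum>v\<in>W. card (neighbours E W v))"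
    using * by (intro sum_mono) (auto simp: not_le)
  ultimately show False
    using sum_card_neighbours[OF assms(1,3)] by simp
qed

section \<open>Realizations of independence complexes\<close>

lemma comm_group_reduced_homology_group [simp]: "comm_group (reduced_homology_group p X)"
  unfolding reduced_homology_group_def
  by (rule group.abelian_subgroup_generated) simp_all

text \<open>The straight-line homotopy; its continuity can be checked in each coordinate because the
  function space carries the product topology.\<close>

lemma homotopic_with_segments:
  fixes f g :: "'b::topological_space \<Rightarrow> 'a \<Rightarrow> real"
  assumes "continuous_on S f" "continuous_on S g"
    and "\<And>x t. x \<in> S \<Longrightarrow> 0 \<le> t \<Longrightarrow> t \<le> 1 \<Longrightarrow> (\<lambda>u. (1 - t) * f x u + t * g x u) \<in> T"
  shows "homotopic_with (\<lambda>_. True) (top_of_set S) (top_of_set T) f g"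
proof -
  define h where "h = (\<lambda>p u. (1 - fst p) * f (snd p) u + fst p * g (snd p) u)"
  have coord: "continuous_on ({0..1} \<times> S) (\<lambda>p. k (snd p) u)" if "continuous_on S k"
    for k :: "'b \<Rightarrow> 'a \<Rightarrow> real" and u
    by (rule continuous_on_compose2[OF continuous_on_product_then_coordinatewise[OF that], where f = snd])
      (auto intro: continuous_intros)
  have "continuous_on ({0..1} \<times> S) h"
    unfolding h_def
    by (intro continuous_on_coordinatewise_then_product continuous_intros coord assms)
  moreover have "h \<in> {0..1} \<times> S \<rightarrow> T"
    using assms(3) by (auto simp: h_def)
  ultimately show ?thesis
    unfolding homotopic_with_def
    by (intro exI[of _ h]) (auto simp: h_def)
qed

text \<open>The coordinates are summed over the fixed set \<open>W\<close> rather than over the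
  varying support. For finite \<open>W\<close> this gives the same value and makes the condition
  linear in the point.\<close>

definition indep_realization :: "'a set set \<Rightarrow> 'a set \<Rightarrow> ('a \<Rightarrow> real) set" where
  "indep_realization E W = {x. (\<forall>v. 0 \<le> x v) \<and> {v. x v \<noteq> 0} \<subseteq> W \<and> indep {v. x v \<noteq> 0} E \<and> (\<Sum>v\<in>W. x v) = 1}"

lemma geometric_realization_independence_complex:
  assumes "finite W"
  shows "geometric_realization (independence_complex W E) = top_of_set (indep_realization E W)"
proof -
  have "(\<Sum>v | x v \<noteq> 0. x v) = (\<Sum>v\<in>W. x v)" if "{v. x v \<noteq> 0} \<subseteq> W" for x :: "'a \<Rightarrow> real"
    using that assms by (intro sum.mono_neutral_left) auto
  then have "{x. (\<forall>v. 0 \<le> x v) \<and> {v. x v \<noteq> 0} \<in> independence_complex W E \<and> (\<Sum>v | x v \<noteq> 0. x v) = 1}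
      = indep_realization E W"
    by (auto simp: indep_realization_def independence_complex_def)
  then show ?thesis
    by (simp add: geometric_realization_def euclidean_product_topology)
qed

lemma indep_realization_mono:
  assumes "finite W" "W' \<subseteq> W"
  shows "indep_realization E W' \<subseteq> indep_realization E W"
proof
  fix x assume x: "x \<in> indep_realization E W'"
  have "(\<Sum>v\<in>W'. x v) = (\<Sum>v\<in>W. x v)"
    using x assms by (intro sum.mono_neutral_left) (auto simp: indep_realization_def)
  then show "x \<in> indep_realization E W"
    using x assms by (auto simp: indep_realization_def)
qed

lemma indep_realization_restrict:
  assumes "finite W" "W' \<subseteq> W" "x \<in> indep_realization E W" "{v. x v \<noteq> 0} \<subseteq> W'"
  shows "x \<in> indep_realization E W'"
proof -
  have "(\<Sum>v\<in>W'. x v) = (\<Sum>v\<in>W. x v)"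
    using assms by (intro sum.mono_neutral_left) auto
  then show ?thesis
    using assms by (auto simp: indep_realization_def)
qed

text \<open>Independence of the union of the supports puts both points into one simplex, which is
  convex.\<close>

lemma indep_realization_segment:
  assumes "x \<in> indep_realization E W" "y \<in> indep_realization E W"
    and "indep ({v. x v \<noteq> 0} \<union> {v. y v \<noteq> 0}) E" "0 \<le> t" "t \<le> 1"
  shows "(\<lambda>u. (1 - t) * x u + t * y u) \<in> indep_realization E W"
proof -
  have sub: "{u. (1 - t) * x u + t * y u \<noteq> 0} \<subseteq> {v. x v \<noteq> 0} \<union> {v. y v \<noteq> 0}"
    by auto
  moreover have "(\<Sum>u\<in>W. (1 - t) * x u + t * y u) = (1 - t) * (\<Sum>u\<in>W. x u) + t * (\<Sum>u\<in>W. y u)"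
    by (simp add: sum.distrib sum_distrib_left)
  ultimately show ?thesis
    using assms smaller_indep[OF assms(3) sub] by (auto simp: indep_realization_def)
qed

section \<open>Contractions towards a vertex\<close>

definition vertex_point :: "'a \<Rightarrow> 'a \<Rightarrow> real" where
  "vertex_point v = (\<lambda>u. if u = v then 1 else 0)"

lemma vertex_point_support [simp]: "{u. vertex_point v u \<noteq> 0} = {v}"
  by (auto simp: vertex_point_def)

lemma vertex_point_in_realization:
  assumes "finite W" "v \<in> W"
  shows "vertex_point v \<in> indep_realization E W"
proof -
  have "indep {u. vertex_point v u \<noteq> 0} E" by (auto simp: indep_def)
  then show ?thesis
    using assms by (auto simp: indep_realization_def) (auto simp: vertex_point_def)
qed

lemma indep_realization_empty_iff:
  assumes "finite W"
  shows "indep_realization E W = {} \<longleftrightarrow> W = {}"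
proof
  show "indep_realization E W = {} \<Longrightarrow> W = {}"
    using vertex_point_in_realization[OF assms, of _ E] by blast
qed (simp add: indep_realization_def)

text \<open>Every point is moved straight to \<open>v\<close>. The last hypothesis allows
  \<open>S\<close> to be a proper part of the realization, such as a neighbourhood of
  \<open>v\<close>.\<close>

lemma contractible_space_toward_vertex:
  assumes "finite W" "v \<in> W"
    and "S \<subseteq> indep_realization E W" "\<And>x. x \<in> S \<Longrightarrow> indep (insert v {u. x u \<noteq> 0}) E"
    and "\<And>x t. x \<in> S \<Longrightarrow> 0 \<le> t \<Longrightarrow> t \<le> 1 \<Longrightarrow>
      (\<lambda>u. (1 - t) * x u + t * vertex_point v u) \<in> indep_realization E W \<Longrightarrow>
      (\<lambda>u. (1 - t) * x u + t * vertex_point v u) \<in> S"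
  shows "contractible_space (top_of_set S)"
proof -
  have "homotopic_with (\<lambda>_. True) (top_of_set S) (top_of_set S) id (\<lambda>_. vertex_point v)"
  proof (rule homotopic_with_segments)
    fix x and t :: real
    assume x: "x \<in> S" "0 \<le> t" "t \<le> 1"
    have "(\<lambda>u. (1 - t) * x u + t * vertex_point v u) \<in> indep_realization E W"
      by (rule indep_realization_segment) (use x assms vertex_point_in_realization in auto)
    then show "(\<lambda>u. (1 - t) * id x u + t * vertex_point v u) \<in> S"
      using assms(5) x by simp
  qed auto
  then show ?thesis
    unfolding contractible_space_def by blast
qed

text \<open>An isolated vertex can be added to every independent set, so the complex is a cone with
  apex \<open>v\<close>.\<close>

lemma contractible_space_isolated_vertex:
  assumes "finite W" "v \<in> W" "neighbours E W v = {}"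
  shows "contractible_space (top_of_set (indep_realization E W))"
proof (rule contractible_space_toward_vertex[OF assms(1,2)])
  fix x assume "x \<in> indep_realization E W"
  then show "indep (insert v {u. x u \<noteq> 0}) E"
    using assms(3) by (auto simp: indep_realization_def indep_def neighbours_def insert_commute)
qed auto

section \<open>Homotopy equivalences given by projection from a vertex\<close>

text \<open>Projection from \<open>v\<close> to the opposite faces; identically 0 where \<open>x v = 1\<close>.\<close>

definition forget_vertex :: "'a \<Rightarrow> ('a \<Rightarrow> real) \<Rightarrow> 'a \<Rightarrow> real" where
  "forget_vertex v x = (\<lambda>u. if u = v then 0 else x u / (1 - x v))"

lemma continuous_on_forget_vertex:
  assumes "\<And>x. x \<in> S \<Longrightarrow> x v < 1"
  shows "continuous_on S (forget_vertex v)"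
proof (rule continuous_on_coordinatewise_then_product)
  fix u
  have "\<And>x. x \<in> S \<Longrightarrow> 1 - x v \<noteq> 0"
    using assms by fastforce
  moreover have c: "continuous_on S (\<lambda>x. x w)" for w
    by (rule continuous_on_subset[OF continuous_on_product_coordinates]) simp
  ultimately show "continuous_on S (\<lambda>x. forget_vertex v x u)"
    unfolding forget_vertex_def by (cases "u = v") (auto intro!: continuous_intros)
qed

lemma forget_vertex_support:
  "x v < 1 \<Longrightarrow> {u. forget_vertex v x u \<noteq> 0} = {u. x u \<noteq> 0} - {v}"
  by (auto simp: forget_vertex_def)

lemma forget_vertex_in_realization:
  assumes "finite W" "v \<in> W" "x \<in> indep_realization E W" "x v < 1"
  shows "forget_vertex v x \<in> indep_realization E (W - {v})"
proof -
  have "x v + (\<Sum>u\<in>W - {v}. x u) = 1"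
    using assms sum.remove[OF assms(1,2), of x] by (simp add: indep_realization_def)
  moreover have "(\<Sum>u\<in>W - {v}. forget_vertex v x u) = (\<Sum>u\<in>W - {v}. x u / (1 - x v))"
    by (intro sum.cong) (auto simp: forget_vertex_def)
  ultimately have "(\<Sum>u\<in>W - {v}. forget_vertex v x u) = 1"
    using assms(4) by (simp flip: sum_divide_distrib)
  moreover have "indep ({u. x u \<noteq> 0} - {v}) E"
    using assms(3) by (auto simp: indep_realization_def intro: smaller_indep)
  moreover have "\<forall>u. 0 \<le> forget_vertex v x u"
    using assms by (auto simp: forget_vertex_def indep_realization_def)
  ultimately show ?thesis
    using assms forget_vertex_support[of x v] by (auto simp: indep_realization_def)
qed

text \<open>The condition \<open>x v < 1\<close> removes only the vertex \<open>v\<close> itself.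
  The remaining points are pushed along the rays from \<open>v\<close> onto the faces that do not
  contain \<open>v\<close>.\<close>

lemma homotopy_equivalent_delete_vertex:
  assumes "finite W" "v \<in> W"
  shows "top_of_set {x \<in> indep_realization E W. x v < 1}
    homotopy_equivalent_space top_of_set (indep_realization E (W - {v}))"
    (is "top_of_set ?T homotopy_equivalent_space top_of_set ?A")
  unfolding homotopy_equivalent_space_def
proof (intro exI conjI)
  let ?r = "forget_vertex v"
  have "x v = 0" if "x \<in> ?A" for x
    using that by (auto simp: indep_realization_def)
  then have AT: "?A \<subseteq> ?T"
    using indep_realization_mono[OF assms(1), of "W - {v}" E] by fastforce
  have r: "?r x \<in> ?A" if "x \<in> ?T" for x
    using that by (intro forget_vertex_in_realization assms) auto
  show "continuous_map (top_of_set ?T) (top_of_set ?A) ?r"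
    using r continuous_on_forget_vertex[of ?T v] by auto
  show "continuous_map (top_of_set ?A) (top_of_set ?T) id"
    using AT by auto
  show "homotopic_with (\<lambda>x. True) (top_of_set ?T) (top_of_set ?T) (id \<circ> ?r) id"
  proof (rule homotopic_with_segments)
    fix x and t :: real
    assume x: "x \<in> ?T" "0 \<le> t" "t \<le> 1"
    have "indep {u. x u \<noteq> 0} E" using x by (simp add: indep_realization_def)
    moreover have "{u. ?r x u \<noteq> 0} \<union> {u. x u \<noteq> 0} = {u. x u \<noteq> 0}"
      using x forget_vertex_support[of x v] by auto
    ultimately have "(\<lambda>u. (1 - t) * ?r x u + t * x u) \<in> indep_realization E W"
      using x r[of x] AT by (intro indep_realization_segment) auto
    \<comment> \<open>The projection has coordinate 0 at \<open>v\<close>, so the homotopy has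
      coordinate \<open>t * x v\<close> there, which stays below 1.\<close>
    moreover have "t * x v \<le> 1 * x v"
      by (rule mult_right_mono) (use x in \<open>auto simp: indep_realization_def\<close>)
    ultimately show "(\<lambda>u. (1 - t) * (id \<circ> ?r) x u + t * id x u) \<in> ?T"
      using x by (simp add: forget_vertex_def)
  qed (auto intro: continuous_on_forget_vertex)
  have "?r x = x" if "x \<in> ?A" for x
  proof -
    have "x v = 0" using that by (auto simp: indep_realization_def)
    then show ?thesis by (auto simp: forget_vertex_def)
  qed
  then show "homotopic_with (\<lambda>x. True) (top_of_set ?A) (top_of_set ?A) (?r \<circ> id) id"
    by (intro homotopic_with_equal) (auto intro: continuous_on_eq[OF continuous_on_id])
qed

text \<open>Near \<open>v\<close>, but away from it, every support contains \<open>v\<close> and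
  therefore avoids its neighbours. Projection from \<open>v\<close> thus lands in the link of
  \<open>v\<close>, which is the independence complex of the graph without \<open>v\<close> and its
  neighbours.\<close>

lemma homotopy_equivalent_punctured_star:
  assumes "finite W" "v \<in> W"
  shows "top_of_set {x \<in> indep_realization E W. 1/2 < x v \<and> x v < 1}
    homotopy_equivalent_space top_of_set (indep_realization E (W - insert v (neighbours E W v)))"
    (is "top_of_set ?M homotopy_equivalent_space top_of_set ?L")
  unfolding homotopy_equivalent_space_def
proof (intro exI conjI)
  let ?r = "forget_vertex v"
  \<comment> \<open>The homotopy inverse places the link at constant height: 3/4 is a value strictly
    between 1/2 and 1, and the factor 1/4 restores total weight 1.\<close>
  let ?j = "\<lambda>y u. if u = v then 3/4 else y u / (4::real)"
  have r: "?r x \<in> ?L" if "x \<in> ?M" for x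
  proof (rule indep_realization_restrict)
    show "?r x \<in> indep_realization E (W - {v})"
      using that by (intro forget_vertex_in_realization assms) auto
    have "indep {u. x u \<noteq> 0} E" "v \<in> {u. x u \<noteq> 0}" "{u. x u \<noteq> 0} \<subseteq> W"
      using that by (auto simp: indep_realization_def)
    then show "{u. ?r x u \<noteq> 0} \<subseteq> W - insert v (neighbours E W v)"
      using that forget_vertex_support[of x v] by (auto simp: indep_def neighbours_def)
  qed (use assms in auto)
  have rj: "?r (?j y) = y" if "y \<in> ?L" for y
  proof -
    have "y v = 0" using that by (auto simp: indep_realization_def)
    then show ?thesis by (auto simp: forget_vertex_def)
  qed
  have j: "?j y \<in> ?M" if "y \<in> ?L" for y
  proof -
    have y: "\<forall>u. 0 \<le> y u" "{u. y u \<noteq> 0} \<subseteq> W - insert v (neighbours E W v)" "indep {u. y u \<noteq> 0} E"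
      using that by (auto simp: indep_realization_def)
    have "(\<Sum>u\<in>W. y u) = 1"
      using that indep_realization_mono[OF assms(1), of "W - insert v (neighbours E W v)" E]
      by (auto simp: indep_realization_def)
    moreover have "y v = 0" using y by auto
    ultimately have "(\<Sum>u\<in>W - {v}. y u) = 1"
      using sum.remove[OF assms, of y] by simp
    moreover have "(\<Sum>u\<in>W - {v}. ?j y u) = (\<Sum>u\<in>W - {v}. y u / 4)"
      by (intro sum.cong) auto
    ultimately have "(\<Sum>u\<in>W. ?j y u) = 1"
      using sum.remove[OF assms, of "?j y"] by (simp flip: sum_divide_distrib)
    moreover have "{u. ?j y u \<noteq> 0} = insert v {u. y u \<noteq> 0}" by auto
    moreover have "indep (insert v {u. y u \<noteq> 0}) E"
      using y by (auto simp: indep_def neighbours_def insert_commute)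
    ultimately show ?thesis
      using y assms(2) by (auto simp: indep_realization_def)
  qed
  have cj: "continuous_on S ?j" for S
  proof (rule continuous_on_coordinatewise_then_product)
    fix u
    have "continuous_on S (\<lambda>x. x u)"
      by (rule continuous_on_subset[OF continuous_on_product_coordinates]) simp
    then show "continuous_on S (\<lambda>x. ?j x u)"
      by (cases "u = v") (auto intro!: continuous_intros)
  qed
  show cr: "continuous_map (top_of_set ?M) (top_of_set ?L) ?r"
    using r continuous_on_forget_vertex[of ?M v] by auto
  show "continuous_map (top_of_set ?L) (top_of_set ?M) ?j"
    using j cj by auto
  show "homotopic_with (\<lambda>x. True) (top_of_set ?M) (top_of_set ?M) (?j \<circ> ?r) id"
  proof (rule homotopic_with_segments)
    show "continuous_on ?M (?j \<circ> ?r)"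
      by (rule continuous_on_compose[OF _ cj]) (auto intro: continuous_on_forget_vertex)
    fix x and t :: real
    assume x: "x \<in> ?M" "0 \<le> t" "t \<le> 1"
    have "indep {u. x u \<noteq> 0} E" using x by (simp add: indep_realization_def)
    moreover have "{u. ?j (?r x) u \<noteq> 0} \<union> {u. x u \<noteq> 0} = {u. x u \<noteq> 0}"
      using x by (auto simp: forget_vertex_def split: if_splits)
    ultimately have "(\<lambda>u. (1 - t) * ?j (?r x) u + t * x u) \<in> indep_realization E W"
      using x j[OF r[OF x(1)]] by (intro indep_realization_segment) auto
    \<comment> \<open>A convex combination of 3/4 and \<open>x v\<close> stays in the open interval
      from 1/2 to 1; the case \<open>t = 1\<close> is separated to keep the inequalities
      strict.\<close>
    moreover have "1/2 < (1 - t) * (3/4) + t * x v" "(1 - t) * (3/4) + t * x v < 1"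
    proof -
      have "t * (1/2) \<le> t * x v" "t * x v \<le> t * 1"
        by (intro mult_left_mono; use x in auto)+
      moreover have "t = 1 \<or> t < 1" using x by auto
      ultimately show "1/2 < (1 - t) * (3/4) + t * x v" "(1 - t) * (3/4) + t * x v < 1"
        using x by (auto simp: field_simps)
    qed
    ultimately show "(\<lambda>u. (1 - t) * (?j \<circ> ?r) x u + t * id x u) \<in> ?M"
      by simp
  qed auto
  show "homotopic_with (\<lambda>x. True) (top_of_set ?L) (top_of_set ?L) (?r \<circ> ?j) id"
    using rj by (intro homotopic_with_equal) (auto intro: continuous_on_eq[OF continuous_on_id])
qed

section \<open>Deleting a vertex from the independence complex\<close>

text \<open>With the convention for the (-1)-sphere built in, the exact sequence of a vertex deletion also
  holds when \<open>G - N[v]\<close> is empty.\<close>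

definition indep_betti :: "'a set set \<Rightarrow> int \<Rightarrow> 'a set \<Rightarrow> enat" where
  "indep_betti E k W = (if W = {} then (if k = -1 then 1 else 0)
     else abelian_rank (reduced_homology_group k (top_of_set (indep_realization E W))))"

text \<open>Kept apart from \<open>indep_betti\<close> because a nontrivial torsion group has rank 0
  and yet counts for the homological dimension.\<close>

definition indep_nonvanishing :: "'a set set \<Rightarrow> int \<Rightarrow> 'a set \<Rightarrow> bool" where
  "indep_nonvanishing E k W \<longleftrightarrow> (if W = {} then k = -1
     else \<not> trivial_group (reduced_homology_group k (top_of_set (indep_realization E W))))"

lemma isolated_vertex_vanishing:
  assumes "finite W" "v \<in> W" "neighbours E W v = {}"
  shows "indep_betti E k W = 0" "\<not> indep_nonvanishing E k W"
proof -
  have "trivial_group (reduced_homology_group k (top_of_set (indep_realization E W)))"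
    by (rule trivial_reduced_homology_group_contractible_space[OF contractible_space_isolated_vertex[OF assms]])
  moreover have "W \<noteq> {}"
    using assms(2) by auto
  ultimately show "indep_betti E k W = 0" "\<not> indep_nonvanishing E k W"
    by (simp_all add: indep_betti_def indep_nonvanishing_def abelian_rank_trivial_group)
qed

text \<open>Excision of the closed set \<open>x v \<le> 1/2\<close>, which lies inside the open set
  \<open>x v < 1\<close>, leaves only a neighbourhood of \<open>v\<close>.\<close>

lemma relative_homology_isomorphic_star:
  assumes "finite W" "v \<in> W"
  shows "relative_homology_group k (top_of_set {x \<in> indep_realization E W. 1/2 < x v})
      {x \<in> indep_realization E W. 1/2 < x v \<and> x v < 1}
    \<cong> relative_homology_group k (top_of_set (indep_realization E W)) {x \<in> indep_realization E W. x v < 1}"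
proof -
  let ?Q = "indep_realization E W"
  let ?X = "top_of_set ?Q" and ?T = "{x \<in> ?Q. x v < 1}" and ?U = "{x \<in> ?Q. x v \<le> 1/2}"
  have c: "continuous_on ?Q (\<lambda>x. x v)"
    by (rule continuous_on_subset[OF continuous_on_product_coordinates]) simp
  have "closedin ?X ?U"
    using continuous_closedin_preimage[OF c, of "{..1/2}"] by (simp add: vimage_def Int_def)
  moreover have "openin ?X ?T"
    using continuous_openin_preimage_gen[OF c, of "{..<1}"] by (simp add: vimage_def Int_def)
  moreover have "?U \<subseteq> ?T" by auto
  ultimately have "?X closure_of ?U \<subseteq> ?X interior_of ?T"
    by (simp add: closure_of_closedin interior_of_openin)
  then have iso: "hom_induced k (subtopology ?X (?Q - ?U)) (?T - ?U) (subtopology ?X ?Q) ?T id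
    \<in> iso (relative_homology_group k (subtopology ?X (?Q - ?U)) (?T - ?U))
          (relative_homology_group k (subtopology ?X ?Q) ?T)"
    by (rule homology_excision_axiom) auto
  have eqs: "subtopology ?X (?Q - ?U) = top_of_set {x \<in> ?Q. 1/2 < x v}"
    "?T - ?U = {x \<in> ?Q. 1/2 < x v \<and> x v < 1}" "subtopology ?X ?Q = ?X"
    unfolding subtopology_subtopology by (auto intro!: arg_cong[of _ _ "subtopology euclidean"])
  from iso show ?thesis
    unfolding eqs by (rule is_isoI)
qed

text \<open>After excision the ambient space is contractible, so the relative homology is the
  reduced homology of the punctured neighbourhood one degree lower, and that space is equivalent to
  the realization for \<open>L\<close>. For empty \<open>L\<close> the punctured neighbourhood is
  empty too, and this case is computed directly.\<close>

lemma relative_homology_star: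
  fixes E :: "'a set set" and k :: int
  assumes "finite W" "v \<in> W"
  defines "R \<equiv> relative_homology_group k (top_of_set (indep_realization E W)) {x \<in> indep_realization E W. x v < 1}"
    and "L \<equiv> W - insert v (neighbours E W v)"
  shows "abelian_rank R \<le> indep_betti E (k - 1) L"
    and "\<not> trivial_group R \<Longrightarrow> indep_nonvanishing E (k - 1) L"
proof -
  let ?Q = "indep_realization E W"
  let ?Y = "{x \<in> ?Q. 1/2 < x v}" and ?M = "{x \<in> ?Q. 1/2 < x v \<and> x v < 1}"
  have R: "relative_homology_group k (top_of_set ?Y) ?M \<cong> R"
    unfolding R_def by (rule relative_homology_isomorphic_star) fact+
  have contr: "contractible_space (top_of_set ?Y)"
  proof (rule contractible_space_toward_vertex[OF assms(1,2)])
    fix x assume x: "x \<in> ?Y"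
    then have "insert v {u. x u \<noteq> 0} = {u. x u \<noteq> 0}" by auto
    then show "indep (insert v {u. x u \<noteq> 0}) E"
      using x by (simp add: indep_realization_def)
    fix t :: real assume t: "0 \<le> t" "t \<le> 1"
    have "(1 - t) * (1/2) \<le> (1 - t) * x v"
      using x t by (intro mult_left_mono) auto
    \<comment> \<open>For \<open>t = 0\<close> the strict bound is that of \<open>x\<close>; for
      positive \<open>t\<close> it comes from the weight moved to \<open>v\<close>.\<close>
    moreover have "t = 0 \<or> t > 0" using t by auto
    ultimately have "1/2 < (1 - t) * x v + t" using x by auto
    then show "(\<lambda>u. (1 - t) * x u + t * vertex_point v u) \<in> ?Y"
      if "(\<lambda>u. (1 - t) * x u + t * vertex_point v u) \<in> ?Q"
      using that by (simp add: vertex_point_def)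
  qed auto
  have eqv: "top_of_set ?M homotopy_equivalent_space top_of_set (indep_realization E L)"
    unfolding L_def by (rule homotopy_equivalent_punctured_star) fact+
  have finL: "finite L" using assms by (simp add: L_def)
  \<comment> \<open>Maps in both directions exist, so the two spaces are empty together.\<close>
  have M_empty: "?M = {} \<longleftrightarrow> L = {}"
  proof -
    obtain f g where "continuous_map (top_of_set ?M) (top_of_set (indep_realization E L)) f"
      "continuous_map (top_of_set (indep_realization E L)) (top_of_set ?M) g"
      using eqv unfolding homotopy_equivalent_space_def by blast
    then have "f \<in> ?M \<rightarrow> indep_realization E L" "g \<in> indep_realization E L \<rightarrow> ?M"
      by (auto simp: continuous_map_def)
    then have "?M = {} \<longleftrightarrow> indep_realization E L = {}" by blast
    then show ?thesis using indep_realization_empty_iff[OF finL] by simp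
  qed
  have "abelian_rank R \<le> indep_betti E (k - 1) L \<and> (\<not> trivial_group R \<longrightarrow> indep_nonvanishing E (k - 1) L)"
  proof (cases "L = {}")
    case False
    then have "?M \<noteq> {}"
      using M_empty by simp
    then have "relative_homology_group k (top_of_set ?Y) ?M \<cong> reduced_homology_group (k - 1) (subtopology (top_of_set ?Y) ?M)"
      by (intro isomorphic_group_relative_homology_of_contractible[OF contr]) auto
    also have "subtopology (top_of_set ?Y) ?M = top_of_set ?M"
      unfolding subtopology_subtopology by (rule arg_cong[of _ _ "subtopology euclidean"]) auto
    also have "reduced_homology_group (k - 1) (top_of_set ?M) \<cong> reduced_homology_group (k - 1) (top_of_set (indep_realization E L))"
      by (rule homotopy_equivalent_space_imp_isomorphic_reduced_homology_groups[OF eqv])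
    finally have iso: "relative_homology_group k (top_of_set ?Y) ?M \<cong> reduced_homology_group (k - 1) (top_of_set (indep_realization E L))" .
    have "abelian_rank R = abelian_rank (reduced_homology_group (k - 1) (top_of_set (indep_realization E L)))"
      using abelian_rank_iso[OF _ _ R] abelian_rank_iso[OF _ _ iso] by (simp add: R_def)
    moreover have "trivial_group R \<longleftrightarrow> trivial_group (reduced_homology_group (k - 1) (top_of_set (indep_realization E L)))"
      using isomorphic_group_triviality[OF R] isomorphic_group_triviality[OF iso] by (simp add: R_def)
    ultimately show ?thesis
      using False by (simp add: indep_betti_def indep_nonvanishing_def)
  next
    case True
    then have "?M = {}"
      using M_empty by simp
    have H: "homology_group k (top_of_set ?Y) \<cong> R"
      using R unfolding \<open>?M = {}\<close> .
    show ?thesis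
    proof (cases "k = 0")
      \<comment> \<open>Outside degree 0 reduced and unreduced homology agree, and the former
        vanishes on a contractible space.\<close>
      case False
      then have "trivial_group (homology_group k (top_of_set ?Y))"
        using trivial_reduced_homology_group_contractible_space[OF contr, of k]
        by (simp add: un_reduced_homology_group)
      then have "trivial_group R"
        using isomorphic_group_triviality[OF H] by (simp add: R_def)
      then show ?thesis
        by (simp add: abelian_rank_trivial_group R_def)
    next
      \<comment> \<open>The unreduced group in degree 0 is infinite cyclic. This matches the
        (-1)-sphere, whose one class sits in degree \<open>k - 1 = -1\<close>.\<close>
      assume "k = 0"
      have "vertex_point v \<in> ?Y"
        using vertex_point_in_realization[OF assms(1,2)] by (simp add: vertex_point_def)
      then have "homology_group 0 (top_of_set ?Y) \<cong> integer_group"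
        using contractible_imp_path_connected_space[OF contr]
        by (intro isomorphic_integer_zeroth_homology_group) auto
      then have "abelian_rank R \<le> 1"
        using abelian_rank_iso[OF _ _ H] abelian_rank_iso[of "homology_group 0 (top_of_set ?Y)" integer_group]
          abelian_rank_integer_group abelian_integer_group \<open>k = 0\<close> by (simp add: R_def)
      then show ?thesis
        using True \<open>k = 0\<close> by (simp add: indep_betti_def indep_nonvanishing_def)
    qed
  qed
  then show "abelian_rank R \<le> indep_betti E (k - 1) L"
    and "\<not> trivial_group R \<Longrightarrow> indep_nonvanishing E (k - 1) L" by auto
qed

section \<open>The exact sequence of a vertex deletion\<close>

lemma exact_trivial_middle:
  assumes "group B" "f \<in> hom A B" "g \<in> hom B C" "kernel B C g = f ` carrier A" "group A"
    and "trivial_group A" "trivial_group C"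
  shows "trivial_group B"
proof -
  have "carrier B \<subseteq> kernel B C g"
    using hom_in_carrier[OF assms(3)] assms(7) by (auto simp: kernel_def trivial_group_def)
  also have "\<dots> = {\<one>\<^bsub>B\<^esub>}"
    using assms hom_one[OF assms(2)] by (simp add: trivial_group_def)
  finally show ?thesis
    using group.trivial_group_subset[OF assms(1)] by simp
qed

text \<open>Exactness, at the homology of the whole space, of the sequence of the pair formed by the
  realization and its part \<open>x v < 1\<close>. That part is equivalent to the realization for
  \<open>W - {v}\<close>, and the relative group is controlled by
  \<open>relative_homology_star\<close>.\<close>

lemma indep_vertex_deletion:
  fixes E :: "'a set set" and k :: int
  assumes "finite W" "v \<in> W"
  defines "L \<equiv> W - insert v (neighbours E W v)"
  shows "indep_betti E k W \<le> indep_betti E k (W - {v}) + indep_betti E (k - 1) L"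
    and "indep_nonvanishing E k W \<Longrightarrow> indep_nonvanishing E k (W - {v}) \<or> indep_nonvanishing E (k - 1) L"
proof -
  let ?Q = "indep_realization E W"
  let ?X = "top_of_set ?Q" and ?T = "{x \<in> ?Q. x v < 1}"
  let ?A = "top_of_set (indep_realization E (W - {v}))"
  let ?R = "relative_homology_group k ?X ?T"
  have sub: "subtopology ?X ?T = top_of_set ?T"
    unfolding subtopology_subtopology by (rule arg_cong[of _ _ "subtopology euclidean"]) auto
  have iso: "reduced_homology_group k (top_of_set ?T) \<cong> reduced_homology_group k ?A"
    by (rule homotopy_equivalent_space_imp_isomorphic_reduced_homology_groups)
      (rule homotopy_equivalent_delete_vertex, fact+)
  obtain f g where fg: "f \<in> hom (reduced_homology_group k (top_of_set ?T)) (reduced_homology_group k ?X)"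
      "g \<in> hom (reduced_homology_group k ?X) ?R"
      "kernel (reduced_homology_group k ?X) ?R g = f ` carrier (reduced_homology_group k (top_of_set ?T))"
    using homology_exactness_reduced_3[of k ?X ?T] unfolding sub
    by (auto simp: group_hom_def group_hom_axioms_def)
  have ne: "W \<noteq> {}" using assms by auto
  \<comment> \<open>For \<open>W = {v}\<close> the group of the empty realization is trivial in
    every degree, including -1 where \<open>indep_betti\<close> is 1. Replacing its rank by
    \<open>indep_betti\<close> therefore only weakens the bound.\<close>
  have triv: "trivial_group (reduced_homology_group k ?A)" if "W - {v} = {}"
    using that indep_realization_empty_iff[of "W - {v}" E] assms(1)
    by (intro trivial_reduced_homology_group_empty) simp
  have "indep_betti E k W = abelian_rank (reduced_homology_group k ?X)"
    using ne by (simp add: indep_betti_def)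
  also have "\<dots> \<le> abelian_rank (reduced_homology_group k (top_of_set ?T)) + abelian_rank ?R"
    by (rule abelian_rank_exact_le[OF _ _ _ fg]) auto
  also have "abelian_rank (reduced_homology_group k (top_of_set ?T)) = abelian_rank (reduced_homology_group k ?A)"
    by (rule abelian_rank_iso[OF _ _ iso]) auto
  also have "\<dots> + abelian_rank ?R \<le> indep_betti E k (W - {v}) + indep_betti E (k - 1) L"
  proof (rule add_mono)
    show "abelian_rank (reduced_homology_group k ?A) \<le> indep_betti E k (W - {v})"
    proof (cases "W - {v} = {}")
      case True
      then have "abelian_rank (reduced_homology_group k ?A) = 0"
        using triv by (simp only: abelian_rank_trivial_group comm_group_reduced_homology_group)
      then show ?thesis by simp
    qed (simp add: indep_betti_def)
    show "abelian_rank ?R \<le> indep_betti E (k - 1) L"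
      unfolding L_def by (rule relative_homology_star) fact+
  qed
  finally show "indep_betti E k W \<le> indep_betti E k (W - {v}) + indep_betti E (k - 1) L" .
  assume "indep_nonvanishing E k W"
  then have "\<not> trivial_group (reduced_homology_group k ?X)"
    using ne by (simp add: indep_nonvanishing_def)
  then have "\<not> trivial_group (reduced_homology_group k (top_of_set ?T)) \<or> \<not> trivial_group ?R"
    using exact_trivial_middle[OF _ fg] by auto
  then show "indep_nonvanishing E k (W - {v}) \<or> indep_nonvanishing E (k - 1) L"
  proof
    assume "\<not> trivial_group (reduced_homology_group k (top_of_set ?T))"
    then have "\<not> trivial_group (reduced_homology_group k ?A)"
      using isomorphic_group_triviality[OF iso] by simp
    then show ?thesis
      using triv by (auto simp: indep_nonvanishing_def)
  next
    assume "\<not> trivial_group ?R"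
    then show ?thesis
      using relative_homology_star(2)[OF assms(1,2), of k E] by (simp add: L_def)
  qed
qed

section \<open>Induction on the vertex set\<close>

text \<open>The degree shift in the second term is absorbed into a translated set of
  degrees.\<close>

lemma sum_indep_betti_vertex_deletion:
  assumes "finite W" "v \<in> W" "finite F"
  shows "(\<Sum>k\<in>F. indep_betti E k W) \<le> (\<Sum>k\<in>F. indep_betti E k (W - {v}))
    + (\<Sum>k\<in>(\<lambda>k. k - 1) ` F. indep_betti E k (W - insert v (neighbours E W v)))"
proof -
  have "(\<Sum>k\<in>F. indep_betti E k W)
      \<le> (\<Sum>k\<in>F. indep_betti E k (W - {v}) + indep_betti E (k - 1) (W - insert v (neighbours E W v)))"
    using indep_vertex_deletion(1)[OF assms(1,2)] by (intro sum_mono)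
  also have "\<dots> = (\<Sum>k\<in>F. indep_betti E k (W - {v}))
    + (\<Sum>k\<in>(\<lambda>k. k - 1) ` F. indep_betti E k (W - insert v (neighbours E W v)))"
    by (subst sum.reindex) (auto simp: sum.distrib inj_on_def)
  finally show ?thesis .
qed

text \<open>Bounds every finite partial sum of Betti numbers. The set \<open>F\<close> is left
  arbitrary because the induction also uses its translate by -1.\<close>

lemma sum_indep_betti_le:
  assumes "finite W" "finite F" and E: "\<forall>e\<in>E. card e = 2"
  shows "(\<Sum>k\<in>F. indep_betti E k W) \<le> enat (2 ^ nat (induced_h1 E W))"
  using assms(1,2)
proof (induction W arbitrary: F rule: finite_psubset_induct)
  case (psubset W)
  show ?case
  proof (cases "W = {}")
    case True
    have "(\<Sum>k\<in>F. indep_betti E k W) = (\<Sum>k\<in>F. if k = -1 then 1 else 0)"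
      using True by (simp add: indep_betti_def)
    also have "\<dots> \<le> 1"
      using psubset.prems by simp
    also have "1 \<le> enat (2 ^ nat (induced_h1 E W))"
      by (simp add: one_enat_def)
    finally show ?thesis .
  next
    case False
    have vanish: "(\<Sum>k\<in>F. indep_betti E k U) = 0" if "finite U" "v \<in> U" "neighbours E U v = {}" for U v
      using isolated_vertex_vanishing(1)[OF that] by simp
    let ?L = "\<lambda>w. W - insert w (neighbours E W w)"
    have L: "(\<Sum>k\<in>(\<lambda>k. k - 1) ` F. indep_betti E k (?L w)) \<le> enat (2 ^ nat (induced_h1 E (?L w)))"
      if "w \<in> W" for w
      using that psubset.prems by (intro psubset.IH) auto
    consider (cycle) v where "cycle_vertex E W v"
      | (isolated) v where "v \<in> W" "neighbours E W v = {}"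
      | (leaf) v w where "v \<in> W" "neighbours E W v = {w}"
    proof -
      consider v where "cycle_vertex E W v" | v where "v \<in> W" "card (neighbours E W v) \<le> 1"
        using cycle_vertex_or_low_degree[OF psubset.hyps(1) False E] by blast
      then show thesis
      proof cases
        case (2 v)
        have "finite (neighbours E W v)"
          using psubset.hyps by (simp add: neighbours_def)
        moreover have "card (neighbours E W v) = 0 \<or> card (neighbours E W v) = 1"
          using 2 by linarith
        ultimately have "neighbours E W v = {} \<or> (\<exists>w. neighbours E W v = {w})"
          by (auto simp: card_1_singleton_iff)
        then show thesis
          using that 2 by blast
      qed (use that in blast)
    qed
    then show ?thesis
    proof cases
      case cycle
      then have "v \<in> W" by (simp add: cycle_vertex_def)
      have lt: "induced_h1 E (W - {v}) < induced_h1 E W"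
        using induced_h1_cycle_vertex[OF psubset.hyps(1) E cycle] .
      have le: "induced_h1 E (?L v) \<le> induced_h1 E (W - {v})"
        by (rule induced_h1_mono) (use psubset.hyps E in auto)
      \<comment> \<open>Nonnegativity lets the larger cycle rank be written as a successor
        \<open>Suc n\<close>; both smaller graphs then contribute at most
        \<open>2 ^ n\<close>.\<close>
      have "0 \<le> induced_h1 E (W - {v})"
        using induced_h1_mono[of "W - {v}" "{}" E] psubset.hyps E by (auto split: if_splits)
      then obtain n where n: "induced_h1 E W = int (Suc n)"
        using lt by (metis gr0_conv_Suc le_less_trans zero_less_imp_eq_int)
      then have n': "nat (induced_h1 E (W - {v})) \<le> n" "nat (induced_h1 E (?L v)) \<le> n"
        using lt le by auto
      have "(\<Sum>k\<in>F. indep_betti E k (W - {v})) \<le> enat (2 ^ nat (induced_h1 E (W - {v})))"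
        using \<open>v \<in> W\<close> psubset.prems by (intro psubset.IH) auto
      also have "\<dots> \<le> enat (2 ^ n)"
        using n' by (simp add: power_increasing)
      finally have 1: "(\<Sum>k\<in>F. indep_betti E k (W - {v})) \<le> enat (2 ^ n)" .
      have "(\<Sum>k\<in>(\<lambda>k. k - 1) ` F. indep_betti E k (?L v)) \<le> enat (2 ^ nat (induced_h1 E (?L v)))"
        using L \<open>v \<in> W\<close> .
      also have "\<dots> \<le> enat (2 ^ n)"
        using n' by (simp add: power_increasing)
      finally have 2: "(\<Sum>k\<in>(\<lambda>k. k - 1) ` F. indep_betti E k (?L v)) \<le> enat (2 ^ n)" .
      have "(\<Sum>k\<in>F. indep_betti E k W) \<le> enat (2 ^ n) + enat (2 ^ n)"
        using sum_indep_betti_vertex_deletion[OF psubset.hyps(1) \<open>v \<in> W\<close> psubset.prems] add_mono[OF 1 2]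
        by (rule order_trans)
      then show ?thesis
        unfolding n nat_int by (simp add: mult_2)
    next
      case isolated
      then show ?thesis
        using vanish[OF psubset.hyps(1)] by simp
    next
      case leaf
      have "w \<in> W" and "{w, v} \<in> E"
        using leaf by (auto simp: neighbours_def)
      then have "w \<noteq> v"
        using E by fastforce
      \<comment> \<open>The deleted vertex is \<open>w\<close>, not the leaf: removing
        \<open>w\<close> isolates \<open>v\<close>, so this term vanishes and only the graph without
        \<open>w\<close> and its neighbours remains.\<close>
      then have "(\<Sum>k\<in>F. indep_betti E k (W - {w})) = 0"
        using leaf psubset.hyps by (intro vanish[of _ v]) (auto simp: neighbours_def)
      then have "(\<Sum>k\<in>F. indep_betti E k W) \<le> enat (2 ^ nat (induced_h1 E (?L w)))"
        using sum_indep_betti_vertex_deletion[OF psubset.hyps(1) \<open>w \<in> W\<close> psubset.prems, of E] L[OF \<open>w \<in> W\<close>] by simp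
      also have "\<dots> \<le> enat (2 ^ nat (induced_h1 E W))"
        using induced_h1_mono[of W "?L w" E] psubset.hyps E by (simp add: power_increasing nat_mono)
      finally show ?thesis .
    qed
  qed
qed

text \<open>Nonvanishing excludes isolated vertices, so any \<open>v\<close> has a neighbour.
  Deleting \<open>v\<close> keeps the degree; passing to \<open>?L\<close> lowers the degree by 1
  and the number of vertices by at least 2. The empty graph gives equality with
  \<open>k = -1\<close>.\<close>

lemma indep_nonvanishing_degree:
  assumes "finite W" "indep_nonvanishing E k W" and E: "\<forall>e\<in>E. card e = 2"
  shows "2 * (k + 1) \<le> int (card W)"
  using assms(1,2)
proof (induction W arbitrary: k rule: finite_psubset_induct)
  case (psubset W)
  show ?case
  proof (cases "W = {}")
    case True
    then show ?thesis using psubset.prems by (simp add: indep_nonvanishing_def)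
  next
    case False
    then obtain v where v: "v \<in> W" by auto
    then obtain u where u: "u \<in> W" "{u, v} \<in> E"
      using isolated_vertex_vanishing(2)[OF psubset.hyps(1) v] psubset.prems by (auto simp: neighbours_def)
    then have "u \<noteq> v" using E by fastforce
    let ?L = "W - insert v (neighbours E W v)"
    from indep_vertex_deletion(2)[OF psubset.hyps(1) v psubset.prems]
    show ?thesis
    proof
      assume "indep_nonvanishing E k (W - {v})"
      then have "2 * (k + 1) \<le> int (card (W - {v}))"
        using v by (intro psubset.IH) auto
      also have "\<dots> \<le> int (card W)"
        using psubset.hyps by (simp add: card_Diff1_le)
      finally show ?thesis .
    next
      assume "indep_nonvanishing E (k - 1) ?L"
      then have "2 * k \<le> int (card ?L)"
        using v psubset.IH[of ?L "k - 1"] by auto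
      moreover have "card ?L \<le> card (W - {u, v})"
        using u v psubset.hyps by (intro card_mono) (auto simp: neighbours_def)
      moreover have "card (W - {u, v}) + 2 = card W"
        using u v \<open>u \<noteq> v\<close> card_mono[OF psubset.hyps(1), of "{u, v}"] by (simp add: card_Diff_subset)
      ultimately show ?thesis by simp
    qed
  qed
qed

section \<open>Both bounds for the full vertex set\<close>

theorem theorem7p1:
  fixes V :: "'a set" and E :: "'a set set"
  assumes "finite_graph V E"
  shows "ereal_of_enat (total_betti (geometric_realization (independence_complex V E)))
           \<le> ereal (2 powi graph_h1 V E)
       \<and> homological_dim (geometric_realization (independence_complex V E))
           \<le> ereal (real (card V) / 2 - 1)"
proof -
  let ?T = "top_of_set (indep_realization E V)"
  have fin: "finite V" and E: "\<forall>e\<in>E. card e = 2" and EV: "E \<inter> Pow V = E"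
    using assms by (auto simp: finite_graph_def)
  have T: "geometric_realization (independence_complex V E) = ?T"
    using geometric_realization_independence_complex[OF fin] .
  have empty: "topspace ?T = {} \<longleftrightarrow> V = {}"
    using indep_realization_empty_iff[OF fin] by simp
  have h1: "induced_h1 E V = graph_h1 V E"
    by (simp add: induced_h1_def EV)
  \<comment> \<open>Comparison with the empty subgraph; it makes the natural-number exponent agree
    with the integer exponent of the claim.\<close>
  have nonneg: "0 \<le> graph_h1 V E"
    using induced_h1_mono[of V "{}" E] fin E h1 by (auto split: if_splits)
  have sum: "(\<Sum>k\<in>F. indep_betti E k V) \<le> enat (2 ^ nat (graph_h1 V E))" if "finite F" for F
    using sum_indep_betti_le[OF fin that E] h1 by simp
  have "total_betti ?T \<le> enat (2 ^ nat (graph_h1 V E))"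
  proof (cases "V = {}")
    case True
    then show ?thesis using empty by (simp add: total_betti_def one_enat_def)
  next
    case False
    \<comment> \<open>A sum of extended naturals over all degrees is bounded as soon as all its
      finite partial sums are.\<close>
    have "(\<Sum>\<^sub>\<infinity>k\<in>UNIV. indep_betti E k V) \<le> enat (2 ^ nat (graph_h1 V E))"
      by (rule infsum_le_finite_sums) (use sum in \<open>auto intro: nonneg_summable_on_complete\<close>)
    then show ?thesis
      using False empty by (simp add: total_betti_def indep_betti_def)
  qed
  then have "ereal_of_enat (total_betti ?T) \<le> ereal_of_enat (enat (2 ^ nat (graph_h1 V E)))"
    by (simp only: ereal_of_enat_le_iff)
  also have "\<dots> = ereal (2 powi graph_h1 V E)"
    using nonneg by (simp add: power_int_def)
  finally have "ereal_of_enat (total_betti ?T) \<le> ereal (2 powi graph_h1 V E)" .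
  moreover have "homological_dim ?T \<le> ereal (real (card V) / 2 - 1)"
  proof (cases "V = {}")
    case True
    then show ?thesis using empty by (simp add: homological_dim_def one_ereal_def)
  next
    case False
    have "real_of_int k \<le> real (card V) / 2 - 1" if "\<not> trivial_group (reduced_homology_group k ?T)" for k
    proof -
      have "2 * (k + 1) \<le> int (card V)"
        using that False by (intro indep_nonvanishing_degree[OF fin _ E]) (simp add: indep_nonvanishing_def)
      then have "real_of_int (2 * (k + 1)) \<le> real_of_int (int (card V))"
        by (simp only: of_int_le_iff)
      then show ?thesis by simp
    qed
    then show ?thesis
      using False empty by (auto simp: homological_dim_def intro!: SUP_least)
  qed
  ultimately show ?thesis
    unfolding T by blast
qed

end
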